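(* Let $k\ge 0$ and $n\ge 1$ be integers. Among semi-arc $k$-visibility graphs on $n$ vertices, the maximum number of edges is equal to $\binom{n}{2}$ if $n\le 3k+3$, and is at most $(k+1)\left(2n-\frac{k+2}{2}\right)$ if $n>3k+3$.
   Context: All arcs are arcs of circles centered at the origin of the plane. An arc is a set given in polar coordinates by $\{(r,\alpha):\alpha_1\le\alpha\le\alpha_2\}$ with $r>0$, $\alpha_1\in[0,2\pi)$ and $0\le\alpha_2-\alpha_1<2\pi$; the points $(r,\alpha_1)$ and $(r,\alpha_2)$ are its negative and positive endpoints. A (non-degenerate) cone is a 4-sided region of positive area with two opposite sides being arcs of circles centered at the origin and the other two sides being (possibly intersecting) radial line segments. So a cone is either a region $\{(r,\alpha): r_1\le r\le r_2,\ \theta_1\le\alpha\le\theta_2\}$ or a "bow-tie" region through the origin, $\{(r,\alpha):0\le r\le r_1,\ \theta_1\le\alpha\le\theta_2\}\cup\{(r,\alpha):0\le r\le r_2,\ \theta_1+\pi\le\alpha\le\theta_2+\pi\}$; in particular, visibility through the origin is allowed. The two circular sides are called the circular ends of the cone. An arc $k$-visibility graph is a graph whose vertices can be represented by pairwise disjoint arcs such that two distinct vertices are adjacent if and only if there is a cone whose two circular ends are subsets of the two corresponding arcs, one in each, and which intersects at most $k$ arcs of the representation other than these two. A semi-arc $k$-visibility graph is an arc $k$-visibility graph having such a representation in which the negative endpoint of every arc lies on the positive $x$-axis (i.e. $\alpha_1=0$ for every arc). *)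

theory Defs
  imports Complex_Main "HOL-Library.Disjoint_Sets"
begin

text \<open>
  The plane is \<^typ>\<open>complex\<close>; the point with polar coordinates \<open>(r, t)\<close> is \<^term>\<open>rcis r t\<close>.
\<close>

definition circle_part :: "real \<Rightarrow> real \<Rightarrow> real \<Rightarrow> complex set" where
  "circle_part r a b = {rcis r t | t. a \<le> t \<and> t \<le> b}"

text \<open>
  Arcs are indexed by the angle \<open>a\<close> of their negative endpoint \<^term>\<open>rcis r a\<close>. One-point arcs
  (\<open>a = b\<close>) are allowed; full circles are not.
\<close>

definition arc_from :: "real \<Rightarrow> complex set \<Rightarrow> bool" where
  "arc_from a A \<longleftrightarrow>
     (\<exists>r b. r > 0 \<and> 0 \<le> a \<and> a < 2 * pi \<and> 0 \<le> b - a \<and> b - a < 2 * pi \<and> A = circle_part r a b)"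

definition is_arc :: "complex set \<Rightarrow> bool" where
  "is_arc A \<longleftrightarrow> (\<exists>a. arc_from a A)"

text \<open>
  In both predicates \<open>C\<close> is the region and \<open>X\<close>, \<open>Y\<close> are its circular ends. The bounds on
  \<open>b - a\<close> say that the two radial sides are distinct and that the region does not overlap itself.
\<close>

definition plain_cone :: "complex set \<Rightarrow> complex set \<Rightarrow> complex set \<Rightarrow> bool" where
  "plain_cone C X Y \<longleftrightarrow>
     (\<exists>r1 r2 a b. 0 < r1 \<and> r1 < r2 \<and> a < b \<and> b - a < 2 * pi \<and>
        C = {rcis r t | r t. r1 \<le> r \<and> r \<le> r2 \<and> a \<le> t \<and> t \<le> b} \<and>
        X = circle_part r1 a b \<and> Y = circle_part r2 a b)"

definition bow_tie_cone :: "complex set \<Rightarrow> complex set \<Rightarrow> complex set \<Rightarrow> bool" where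
  "bow_tie_cone C X Y \<longleftrightarrow>
     (\<exists>r1 r2 a b. 0 < r1 \<and> 0 < r2 \<and> a < b \<and> b - a < pi \<and>
        C = {rcis r t | r t. 0 \<le> r \<and> r \<le> r1 \<and> a \<le> t \<and> t \<le> b} \<union>
            {rcis r t | r t. 0 \<le> r \<and> r \<le> r2 \<and> a + pi \<le> t \<and> t \<le> b + pi} \<and>
        X = circle_part r1 a b \<and> Y = circle_part r2 (a + pi) (b + pi))"

definition cone :: "complex set \<Rightarrow> complex set \<Rightarrow> complex set \<Rightarrow> bool" where
  "cone C X Y \<longleftrightarrow> plain_cone C X Y \<or> bow_tie_cone C X Y"

definition sees :: "nat \<Rightarrow> 'a set \<Rightarrow> ('a \<Rightarrow> complex set) \<Rightarrow> 'a \<Rightarrow> 'a \<Rightarrow> bool" where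
  "sees k V f u v \<longleftrightarrow>
     (\<exists>C X Y. cone C X Y \<and> (X \<subseteq> f u \<and> Y \<subseteq> f v \<or> X \<subseteq> f v \<and> Y \<subseteq> f u) \<and>
        card {w \<in> V - {u, v}. C \<inter> f w \<noteq> {}} \<le> k)"

definition simple_graph :: "'a set \<Rightarrow> 'a set set \<Rightarrow> bool" where
  "simple_graph V E \<longleftrightarrow> finite V \<and> (\<forall>e\<in>E. e \<subseteq> V \<and> card e = 2)"

definition arc_visibility_rep ::
    "nat \<Rightarrow> 'a set \<Rightarrow> 'a set set \<Rightarrow> ('a \<Rightarrow> complex set) \<Rightarrow> bool" where
  "arc_visibility_rep k V E f \<longleftrightarrow>
     (\<forall>v\<in>V. is_arc (f v)) \<and> disjoint_family_on f V \<and>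
     (\<forall>u\<in>V. \<forall>v\<in>V. u \<noteq> v \<longrightarrow> ({u, v} \<in> E \<longleftrightarrow> sees k V f u v))"

definition arc_visibility_graph :: "nat \<Rightarrow> 'a set \<Rightarrow> 'a set set \<Rightarrow> bool" where
  "arc_visibility_graph k V E \<longleftrightarrow> simple_graph V E \<and> (\<exists>f. arc_visibility_rep k V E f)"

definition semi_arc_visibility_graph :: "nat \<Rightarrow> 'a set \<Rightarrow> 'a set set \<Rightarrow> bool" where
  "semi_arc_visibility_graph k V E \<longleftrightarrow>
     simple_graph V E \<and> (\<exists>f. arc_visibility_rep k V E f \<and> (\<forall>v\<in>V. arc_from 0 (f v)))"

text \<open>
  Every finite graph is isomorphic to one whose vertices are natural numbers, so it suffices to
  range over those. The two lemmas below show that the maximum of this set is meaningful.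
\<close>

definition semi_arc_edge_counts :: "nat \<Rightarrow> nat \<Rightarrow> nat set" where
  "semi_arc_edge_counts k n =
     {card E | (V :: nat set) E. semi_arc_visibility_graph k V E \<and> card V = n}"

lemma sees_commute: "sees k V f u v \<longleftrightarrow> sees k V f v u"
  unfolding sees_def by (simp add: insert_commute disj_commute)

lemma finite_semi_arc_edge_counts: "finite (semi_arc_edge_counts k n)"
proof (rule finite_subset)
  show "semi_arc_edge_counts k n \<subseteq> {..2 ^ n}"
  proof
    fix m assume "m \<in> semi_arc_edge_counts k n"
    then obtain V :: "nat set" and E where m: "m = card E" and n: "card V = n"
      and g: "simple_graph V E"
      by (auto simp: semi_arc_edge_counts_def semi_arc_visibility_graph_def)
    have "finite V" "E \<subseteq> Pow V" using g by (auto simp: simple_graph_def)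
    then have "card E \<le> card (Pow V)" by (intro card_mono) auto
    then show "m \<in> {..2 ^ n}" using m n \<open>finite V\<close> by (simp add: card_Pow)
  qed
qed simp

lemma semi_arc_edge_counts_nonempty: "semi_arc_edge_counts k n \<noteq> {}"
proof -
  let ?V = "{..<n}"
  define f where "f v = circle_part (real v + 1) 0 0" for v :: nat
  define E where "E = {{u, v} | u v. u \<in> ?V \<and> v \<in> ?V \<and> u \<noteq> v \<and> sees k ?V f u v}"
  have f: "f v = {of_nat v + 1}" for v
    by (auto simp: f_def circle_part_def rcis_def intro!: exI[of _ 0])
  have arcs: "arc_from 0 (f v)" for v
    unfolding arc_from_def f_def
    by (intro exI[of _ "real v + 1"] exI[of _ 0]) auto
  have "disjoint_family_on f ?V"
    by (auto simp: disjoint_family_on_def f)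
  moreover have "{u, v} \<in> E \<longleftrightarrow> sees k ?V f u v" if "u \<in> ?V" "v \<in> ?V" "u \<noteq> v" for u v
    using that by (auto simp: E_def doubleton_eq_iff sees_commute)
  ultimately have "arc_visibility_rep k ?V E f"
    using arcs by (auto simp: arc_visibility_rep_def is_arc_def)
  moreover have "simple_graph ?V E" by (auto simp: simple_graph_def E_def)
  ultimately have "semi_arc_visibility_graph k ?V E"
    using arcs by (auto simp: semi_arc_visibility_graph_def)
  then have "card E \<in> semi_arc_edge_counts k n"
    unfolding semi_arc_edge_counts_def by (intro CollectI exI[of _ E] exI[of _ ?V]) simp
  then show ?thesis by blast
qed

end

theory Submission
  imports Defs
begin

text \<open>
  Moving a cone between two semi-arcs to larger angles until it reaches a positive endpoint of one
  of the two only removes blockers. Charge the edge to the arc \<open>x\<close> with that endpoint. Along the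
  outward ray just below the positive endpoint of \<open>x\<close>, every arc met blocks the view of those
  behind it, so at most \<open>k + 1\<close> edges are charged to \<open>x\<close> on that side; the same holds for the
  inward ray, continued through the origin. This gives \<open>2 * (k + 1) * n\<close>, from which
  \<open>(k + 1) * (k + 2) / 2\<close> is saved because the \<open>i\<close>-th outermost arc has at most \<open>i - 1\<close> arcs
  outside it.
\<close>

section \<open>Points of arcs\<close>

lemma rcis_shift: "rcis s (t + 2 * pi * real_of_int m) = rcis s t"
proof -
  have "sin (t + 2 * pi * m) = sin t \<and> cos (t + 2 * pi * m) = cos t"
    unfolding sin_cos_eq_iff by blast
  then show ?thesis by (simp add: complex_eq_iff)
qed

lemma rcis_mem_circle_part_iff:
  assumes "0 < s" "0 < r"
  shows "rcis s t \<in> circle_part r a c \<longleftrightarrow> s = r \<and> (\<exists>m::int. a \<le> t + 2 * pi * m \<and> t + 2 * pi * m \<le> c)"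
proof
  assume "rcis s t \<in> circle_part r a c"
  then obtain t' where eq: "rcis s t = rcis r t'" and t': "a \<le> t'" "t' \<le> c"
    by (auto simp: circle_part_def)
  from eq have "cmod (rcis s t) = cmod (rcis r t')" by simp
  then have "s = r" using assms by simp
  with eq have "cis t = cis t'" using assms by (simp add: rcis_def)
  then have "sin t' = sin t \<and> cos t' = cos t" by (simp add: complex_eq_iff)
  then obtain m :: int where "t' = t + 2 * pi * m" unfolding sin_cos_eq_iff by auto
  with t' \<open>s = r\<close> show "s = r \<and> (\<exists>m::int. a \<le> t + 2 * pi * m \<and> t + 2 * pi * m \<le> c)" by blast
next
  assume "s = r \<and> (\<exists>m::int. a \<le> t + 2 * pi * m \<and> t + 2 * pi * m \<le> c)"
  then obtain m :: int where m: "s = r" "a \<le> t + 2 * pi * m" "t + 2 * pi * m \<le> c" by blast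
  then have "rcis s t = rcis r (t + 2 * pi * m)" by (simp add: rcis_shift)
  with m show "rcis s t \<in> circle_part r a c" by (auto simp: circle_part_def)
qed

text \<open>Lets the whole-turn shifts found separately for the two ends of a cone be
  compared.\<close>

lemma angle_shift_unique:
  assumes "0 \<le> x + 2 * pi * real_of_int m" "x + 2 * pi * real_of_int m < 2 * pi"
    and "0 \<le> x + 2 * pi * real_of_int m'" "x + 2 * pi * real_of_int m' < 2 * pi"
  shows "m = m'"
proof -
  have "2 * pi * (real_of_int m - m') < 2 * pi * 1" "2 * pi * (real_of_int m' - m) < 2 * pi * 1"
    using assms by (simp_all add: algebra_simps)
  then have "real_of_int m - m' < 1" "real_of_int m' - m < 1"
    by (simp_all only: mult_less_cancel_left_pos pi_gt_zero zero_less_mult_iff zero_less_numeral simp_thms)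
  then show ?thesis by linarith
qed

lemma rcis_mem_semi_arc_iff:
  assumes "0 < s" "0 < r" "c < 2 * pi" "0 \<le> t" "t < 2 * pi"
  shows "rcis s t \<in> circle_part r 0 c \<longleftrightarrow> s = r \<and> t \<le> c"
proof -
  have "m = 0" if "0 \<le> t + 2 * pi * real_of_int m" "t + 2 * pi * real_of_int m \<le> c" for m
    using angle_shift_unique[of t m 0] that assms by simp
  then have "(\<exists>m::int. 0 \<le> t + 2 * pi * m \<and> t + 2 * pi * m \<le> c) \<longleftrightarrow> t \<le> c"
    using assms(4) by (metis add_0_right mult_zero_right of_int_0)
  then show ?thesis by (simp add: rcis_mem_circle_part_iff assms)
qed

text \<open>A semi-arc misses the angles strictly between \<open>c\<close> and a full turn, so a
  subarc cannot wrap around and one whole-turn shift \<open>m\<close> serves all its angles.\<close>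

lemma circle_part_subset_semi_arc:
  assumes sub: "circle_part s a b \<subseteq> circle_part r 0 c"
    and "a < b" "0 < s" "0 < r" "c < 2 * pi"
  obtains m :: int where "s = r" "0 \<le> a + 2 * pi * m" "b + 2 * pi * m \<le> c"
proof -
  have mem: "rcis s t \<in> circle_part r 0 c" if "a \<le> t" "t \<le> b" for t
    using sub that by (auto simp: circle_part_def)
  from mem[of a] obtain m :: int where m: "s = r" "0 \<le> a + 2 * pi * m" "a + 2 * pi * m \<le> c"
    using \<open>a < b\<close> by (auto simp: rcis_mem_circle_part_iff assms)
  have "b + 2 * pi * m \<le> c"
  proof (rule ccontr)
    \<comment> \<open>Otherwise an angle of the subarc lies strictly between \<open>c\<close> and a full turn.\<close>
    assume neg: "\<not> b + 2 * pi * m \<le> c"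
    define t where "t = min (b + 2 * pi * m) ((c + 2 * pi) / 2)"
    have t: "c < t" "t < 2 * pi" "t \<le> b + 2 * pi * m" "0 \<le> t" "a + 2 * pi * m \<le> t"
      using neg m \<open>c < 2 * pi\<close> by (auto simp: t_def min_def field_simps)
    from mem[of "t - 2 * pi * m"] t
    obtain m' :: int where m': "0 \<le> t - 2 * pi * m + 2 * pi * m'" "t - 2 * pi * m + 2 * pi * m' \<le> c"
      by (auto simp: rcis_mem_circle_part_iff assms)
    have "m = m'"
      using angle_shift_unique[of "t - 2 * pi * m" m m'] m' t \<open>c < 2 * pi\<close> by simp
    with m' t show False by simp
  qed
  with m that show thesis by blast
qed

section \<open>Counting\<close>

text \<open>The elements counted have distinct keys, so the one with the largest key has all the
  others among its at most \<open>k\<close> predecessors.\<close>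

lemma card_few_predecessors_le:
  fixes key :: "'a \<Rightarrow> real"
  assumes "finite P"
  shows "card {y \<in> P. card {w \<in> P. key w < key y} \<le> k \<and> (\<forall>w\<in>P. key w = key y \<longrightarrow> w = y)} \<le> k + 1"
    (is "card ?S \<le> _")
proof (cases "?S = {}")
  case False
  have fin: "finite ?S" using assms by simp
  then obtain y where y: "y \<in> ?S" "\<And>z. z \<in> ?S \<Longrightarrow> key z \<le> key y"
    using obtains_MAX[OF _ False, of key] by (metis (no_types, lifting) Max_ge finite_imageI imageI)
  have "?S \<subseteq> insert y {w \<in> P. key w < key y}"
  proof
    fix z assume z: "z \<in> ?S"
    have "z = y \<or> key z < key y" using y(1) y(2)[OF z] z by (cases "key z = key y") auto
    then show "z \<in> insert y {w \<in> P. key w < key y}" using z by blast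
  qed
  then have "card ?S \<le> card (insert y {w \<in> P. key w < key y})"
    using assms by (intro card_mono) auto
  also have "\<dots> \<le> Suc (card {w \<in> P. key w < key y})" by (rule card_insert_le_m1) auto
  finally show ?thesis using y(1) by simp
next
  case True
  then show ?thesis by (simp only: card.empty)
qed

text \<open>As \<open>r\<close> is injective, the number of elements with larger \<open>r\<close> is
  a rank taking each value below \<open>card V\<close> exactly once.\<close>

lemma sum_min_card_greater:
  fixes r :: "'a \<Rightarrow> real"
  assumes "finite V" "inj_on r V"
  shows "(\<Sum>x\<in>V. min q (card {y \<in> V. r x < r y})) = (\<Sum>i<card V. min q i)"
proof -
  let ?g = "\<lambda>x. card {y \<in> V. r x < r y}"
  have less: "?g y < ?g x" if "x \<in> V" "y \<in> V" "r x < r y" for x y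
    using that assms by (intro psubset_card_mono) auto
  have inj: "inj_on ?g V"
  proof (rule inj_onI)
    fix x y assume xy: "x \<in> V" "y \<in> V" "?g x = ?g y"
    then have "r x = r y" using less[of x y] less[of y x] by linarith
    then show "x = y" using assms(2) xy by (auto dest: inj_onD)
  qed
  have "?g ` V \<subseteq> {..<card V}"
    using assms(1) by (auto intro!: psubset_card_mono)
  then have "?g ` V = {..<card V}"
    by (rule card_subset_eq[rotated]) (simp_all add: card_image inj)
  then show ?thesis
    by (metis (no_types, lifting) inj sum.reindex_cong)
qed

text \<open>The sum is \<open>q * n - q * (q + 1) / 2\<close>; this form avoids division and
  truncated subtraction.\<close>

lemma sum_min_lessThan:
  fixes q n :: nat
  assumes "q \<le> n"
  shows "2 * (\<Sum>i<n. min q i) + q * (q + 1) = 2 * q * n"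
  using assms
proof (induction n rule: dec_induct)
  case base
  have "(\<Sum>i<q. min q i) = (\<Sum>i<q. i)" by (intro sum.cong) auto
  moreover have "2 * (\<Sum>i<q. i) + q = q * q" by (induction q) auto
  ultimately show ?case by (simp add: algebra_simps)
qed (simp add: algebra_simps)

text \<open>With \<open>S\<close> the positive endpoints of semi-arcs, an arc that reaches angle
  \<open>a\<close> also reaches \<open>L\<close>. This makes cones narrow enough to meet no unwanted
  arcs.\<close>

lemma exists_separating_below:
  fixes L :: real
  assumes "finite S" "0 < L"
  obtains a where "0 \<le> a" "a < L" "\<And>s. s \<in> S \<Longrightarrow> s < L \<Longrightarrow> s < a"
proof
  \<comment> \<open>Inserting 0 keeps the maximum defined when \<open>S\<close> has no element below
    \<open>L\<close>, and makes the midpoint nonnegative.\<close>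
  let ?M = "Max (insert 0 {s \<in> S. s < L})"
  have fin: "finite (insert 0 {s \<in> S. s < L})" using assms by simp
  have M: "?M < L" using fin assms by (subst Max_less_iff) auto
  have M0: "0 \<le> ?M" using fin by (intro Max_ge) auto
  show "0 \<le> (?M + L) / 2" "(?M + L) / 2 < L" using M M0 assms by auto
  show "s < (?M + L) / 2" if "s \<in> S" "s < L" for s
  proof -
    have "s \<le> ?M" using fin that by (intro Max_ge) auto
    then show ?thesis using M by simp
  qed
qed

section \<open>Visibility among semi-arcs\<close>

text \<open>\<open>l v\<close> is both the length of an arc and the angle of its positive endpoint.
  Disjointness enters as distinctness of radii.\<close>

locale semi_arcs =
  fixes V :: "'a set" and f :: "'a \<Rightarrow> complex set" and r l :: "'a \<Rightarrow> real"
  assumes fin: "finite V"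
    and arc: "v \<in> V \<Longrightarrow> f v = circle_part (r v) 0 (l v)"
    and r_pos: "v \<in> V \<Longrightarrow> 0 < r v"
    and l_nonneg: "v \<in> V \<Longrightarrow> 0 \<le> l v"
    and l_less: "v \<in> V \<Longrightarrow> l v < 2 * pi"
    and r_inj: "inj_on r V"
begin

lemma r_eqD: "u \<in> V \<Longrightarrow> v \<in> V \<Longrightarrow> r u = r v \<Longrightarrow> u = v"
  using r_inj by (auto dest: inj_onD)

lemma mem_iff:
  assumes "v \<in> V" "0 \<le> s" "0 \<le> t" "t < 2 * pi"
  shows "rcis s t \<in> f v \<longleftrightarrow> s = r v \<and> t \<le> l v"
proof (cases "s = 0")
  case True
  have "rcis s t \<notin> f v"
  proof
    assume "rcis s t \<in> f v"
    then obtain t' where "rcis s t = rcis (r v) t'" using assms by (auto simp: arc circle_part_def)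
    then show False using True r_pos[OF assms(1)] by (metis less_irrefl rcis_eq_zero_iff rcis_zero_mod)
  qed
  then show ?thesis using True r_pos[OF assms(1)] by simp
next
  case False
  then show ?thesis using assms
    by (simp add: arc rcis_mem_semi_arc_iff r_pos l_less)
qed

lemma subset_arcE:
  assumes "circle_part s a b \<subseteq> f v" "v \<in> V" "a < b" "0 < s"
  obtains m :: int where "s = r v" "0 \<le> a + 2 * pi * m" "b + 2 * pi * m \<le> l v"
  using circle_part_subset_semi_arc[of s a b "r v" "l v"] assms arc r_pos l_less by metis

section \<open>Conditions that visibility forces\<close>

text \<open>For \<open>L\<close> in \<open>[0, 2 * pi)\<close>, a semi-arc crosses the ray at angle
  \<open>L\<close> exactly when \<open>L \<le> l w\<close>, so these are the arcs met on that ray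
  between \<open>u\<close> and \<open>v\<close>.\<close>

definition plain_blockers :: "'a \<Rightarrow> 'a \<Rightarrow> real \<Rightarrow> 'a set" where
  "plain_blockers u v L = {w \<in> V - {u, v}. r u < r w \<and> r w < r v \<and> L \<le> l w}"

text \<open>Here \<open>L\<close> is the final angle of the bow-tie on the side of \<open>u\<close>.\<close>

definition bow_blockers :: "'a \<Rightarrow> 'a \<Rightarrow> real \<Rightarrow> 'a set" where
  "bow_blockers u v L = {w \<in> V - {u, v}. r w < r u \<and> L \<le> l w \<or> r w < r v \<and> L + pi \<le> l w}"

lemma finite_plain_blockers [simp]: "finite (plain_blockers u v L)"
  and finite_bow_blockers [simp]: "finite (bow_blockers u v L)"
  using fin by (simp_all add: plain_blockers_def bow_blockers_def)

text \<open>An arc reaching the largest admissible angle also reaches any smaller \<open>t\<close>,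
  hence meets the segment through the origin at angles \<open>t\<close> and \<open>t + pi\<close>,
  which lies in \<open>C\<close>.\<close>

lemma bow_blockers_subset:
  assumes V: "u \<in> V" "v \<in> V" and t: "0 \<le> t" "t + pi \<le> l v" "t \<le> l u"
    and C: "\<And>s. 0 \<le> s \<Longrightarrow> s \<le> r u \<Longrightarrow> rcis s t \<in> C"
      "\<And>s. 0 \<le> s \<Longrightarrow> s \<le> r v \<Longrightarrow> rcis s (t + pi) \<in> C"
  shows "bow_blockers u v (min (l u) (l v - pi)) \<subseteq> {w \<in> V - {u, v}. C \<inter> f w \<noteq> {}}"
proof
  fix w assume "w \<in> bow_blockers u v (min (l u) (l v - pi))"
  then have w: "w \<in> V - {u, v}" and
    cases: "r w < r u \<and> t \<le> l w \<or> r w < r v \<and> t + pi \<le> l w"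
    using t by (auto simp: bow_blockers_def min_def split: if_splits)
  have rw: "0 \<le> r w" using r_pos[of w] w by auto
  have tl: "t < 2 * pi" "t + pi < 2 * pi" using t l_less[of v] l_less[of u] V by auto
  from cases have "C \<inter> f w \<noteq> {}"
  proof
    assume "r w < r u \<and> t \<le> l w"
    then have "rcis (r w) t \<in> C \<inter> f w" using C(1) mem_iff[of w "r w" t] w t rw tl by auto
    then show ?thesis by blast
  next
    assume "r w < r v \<and> t + pi \<le> l w"
    then have "rcis (r w) (t + pi) \<in> C \<inter> f w"
      using C(2) mem_iff[of w "r w" "t + pi"] w t rw tl by auto
    then show ?thesis by blast
  qed
  with w show "w \<in> {w \<in> V - {u, v}. C \<inter> f w \<noteq> {}}" by blast
qed

text \<open>The final radial side of the cone is at an angle at most \<open>l u\<close> and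
  \<open>l v\<close>, so every arc that blocks at the smaller of these crosses that side.\<close>

lemma plain_cone_necessary:
  assumes cone: "plain_cone C X Y" and sub: "X \<subseteq> f u" "Y \<subseteq> f v" and V: "u \<in> V" "v \<in> V"
    and k: "card {w \<in> V - {u, v}. C \<inter> f w \<noteq> {}} \<le> k"
  shows "r u < r v" "card (plain_blockers u v (min (l u) (l v))) \<le> k"
proof -
  from cone obtain r1 r2 a b where c: "0 < r1" "r1 < r2" "a < b"
    and C: "C = {rcis r t | r t. r1 \<le> r \<and> r \<le> r2 \<and> a \<le> t \<and> t \<le> b}"
    and XY: "X = circle_part r1 a b" "Y = circle_part r2 a b"
    unfolding plain_cone_def by blast
  obtain m :: int where m: "r1 = r u" "0 \<le> a + 2 * pi * m" "b + 2 * pi * m \<le> l u"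
    using subset_arcE[of r1 a b u] sub XY V c by auto
  obtain m' :: int where m': "r2 = r v" "0 \<le> a + 2 * pi * m'" "b + 2 * pi * m' \<le> l v"
    using subset_arcE[of r2 a b v] sub XY V c by auto
  \<comment> \<open>Both shifts bring \<open>a\<close> into \<open>[0, 2 * pi)\<close>.\<close>
  have "m = m'"
    using angle_shift_unique[of a m m'] m m' c l_less[of u] l_less[of v] V by simp
  define t where "t = b + 2 * pi * m"
  have t: "0 \<le> t" "t \<le> l u" "t \<le> l v" "t < 2 * pi"
    using m m' \<open>m = m'\<close> c l_less[of u] V by (auto simp: t_def)
  show "r u < r v" using m m' c by simp
  have "plain_blockers u v (min (l u) (l v)) \<subseteq> {w \<in> V - {u, v}. C \<inter> f w \<noteq> {}}"
  proof
    fix w assume "w \<in> plain_blockers u v (min (l u) (l v))"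
    then have w: "w \<in> V - {u, v}" "r u < r w" "r w < r v" "t \<le> l w"
      using t by (auto simp: plain_blockers_def)
    have "rcis (r w) b \<in> C" using C w m m' c by fastforce
    then have "rcis (r w) t \<in> C" by (simp add: t_def rcis_shift)
    moreover have "rcis (r w) t \<in> f w" using mem_iff[of w "r w" t] w t r_pos[of w] by auto
    ultimately show "w \<in> {w \<in> V - {u, v}. C \<inter> f w \<noteq> {}}" using w by blast
  qed
  then have "card (plain_blockers u v (min (l u) (l v))) \<le> card {w \<in> V - {u, v}. C \<inter> f w \<noteq> {}}"
    using fin by (intro card_mono) auto
  with k show "card (plain_blockers u v (min (l u) (l v))) \<le> k" by simp
qed

text \<open>The minimum is the largest final angle, on the side of \<open>u\<close>, of a bow-tie
  whose opposite end lies on \<open>v\<close>. It must be positive to leave room for a cone.\<close>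

definition bow_visible :: "nat \<Rightarrow> 'a \<Rightarrow> 'a \<Rightarrow> bool" where
  "bow_visible k u v \<longleftrightarrow> 0 < min (l u) (l v - pi) \<and> card (bow_blockers u v (min (l u) (l v - pi))) \<le> k"

text \<open>Reduced to \<open>[0, 2 * pi)\<close>, the end on \<open>u\<close> starts before a half
  turn or not. This decides which of \<open>u\<close> and \<open>v\<close> carries the end with the
  smaller angles.\<close>

lemma bow_tie_cone_necessary:
  assumes cone: "bow_tie_cone C X Y" and sub: "X \<subseteq> f u" "Y \<subseteq> f v" and V: "u \<in> V" "v \<in> V"
    and k: "card {w \<in> V - {u, v}. C \<inter> f w \<noteq> {}} \<le> k"
  shows "bow_visible k u v \<or> bow_visible k v u"
proof -
  from cone obtain r1 r2 a b where c: "0 < r1" "0 < r2" "a < b" "b - a < pi"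
    and C: "C = {rcis r t | r t. 0 \<le> r \<and> r \<le> r1 \<and> a \<le> t \<and> t \<le> b} \<union>
            {rcis r t | r t. 0 \<le> r \<and> r \<le> r2 \<and> a + pi \<le> t \<and> t \<le> b + pi}"
    and XY: "X = circle_part r1 a b" "Y = circle_part r2 (a + pi) (b + pi)"
    unfolding bow_tie_cone_def by blast
  obtain m :: int where m: "r1 = r u" "0 \<le> a + 2 * pi * m" "b + 2 * pi * m \<le> l u"
    using subset_arcE[of r1 a b u] sub XY V c by auto
  obtain m' :: int where m': "r2 = r v" "0 \<le> a + pi + 2 * pi * m'" "b + pi + 2 * pi * m' \<le> l v"
    using subset_arcE[of r2 "a + pi" "b + pi" v] sub XY V c by auto
  have Cb: "rcis s (b + 2 * pi * m) \<in> C" if "0 \<le> s" "s \<le> r u" for s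
    unfolding rcis_shift C Un_iff mem_Collect_eq using m c that
    by (intro disjI1 exI[of _ s] exI[of _ b]) auto
  have Cb': "rcis s (b + pi + 2 * pi * m') \<in> C" if "0 \<le> s" "s \<le> r v" for s
    unfolding rcis_shift C Un_iff mem_Collect_eq using m' c that
    by (intro disjI2 exI[of _ s] exI[of _ "b + pi"]) auto
  show ?thesis
  proof (cases "a + 2 * pi * m < pi")
    case True
    have "m = m'"
      using angle_shift_unique[of "a + pi" m m'] True m m' c l_less[of v] V by simp
    define t where "t = b + 2 * pi * m"
    have t: "0 < t" "t \<le> l u" "t + pi \<le> l v"
      using m m' c \<open>m = m'\<close> by (auto simp: t_def)
    have "bow_blockers u v (min (l u) (l v - pi)) \<subseteq> {w \<in> V - {u, v}. C \<inter> f w \<noteq> {}}"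
      using t V Cb Cb' \<open>m = m'\<close>
      by (intro bow_blockers_subset[where t = t]) (simp_all add: t_def algebra_simps)
    then have "card (bow_blockers u v (min (l u) (l v - pi))) \<le> card {w \<in> V - {u, v}. C \<inter> f w \<noteq> {}}"
      using fin by (intro card_mono) auto
    then show ?thesis using t k by (auto simp: bow_visible_def)
  next
    case False
    \<comment> \<open>The end on \<open>v\<close> now starts half a turn before the end on
      \<open>u\<close>, so \<open>a + pi\<close> takes one full turn less than
      \<open>a\<close>.\<close>
    have "m - 1 = m'"
      using angle_shift_unique[of "a + pi" "m - 1" m'] False m m' c l_less[of v] l_less[of u] V
      by (simp add: algebra_simps)
    then have mm: "m = m' + 1" by simp
    define t where "t = b + pi + 2 * pi * m'"
    have t: "0 < t" "t \<le> l v" "t + pi \<le> l u" "t + pi = b + 2 * pi * m"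
      using m m' c mm by (auto simp: t_def algebra_simps)
    have "bow_blockers v u (min (l v) (l u - pi)) \<subseteq> {w \<in> V - {v, u}. C \<inter> f w \<noteq> {}}"
      using t V Cb[folded t(4)] Cb'[folded t_def]
      by (intro bow_blockers_subset[where t = t]) simp_all
    then have "card (bow_blockers v u (min (l v) (l u - pi))) \<le> card {w \<in> V - {v, u}. C \<inter> f w \<noteq> {}}"
      using fin by (intro card_mono) auto
    then show ?thesis using t k by (auto simp: bow_visible_def insert_commute)
  qed
qed

lemma sees_necessary:
  assumes "sees k V f u v" "u \<in> V" "v \<in> V"
  shows "(r u < r v \<and> card (plain_blockers u v (min (l u) (l v))) \<le> k)
    \<or> (r v < r u \<and> card (plain_blockers v u (min (l v) (l u))) \<le> k)
    \<or> bow_visible k u v \<or> bow_visible k v u"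
proof -
  from assms(1) obtain C X Y where "cone C X Y"
    and sub: "X \<subseteq> f u \<and> Y \<subseteq> f v \<or> X \<subseteq> f v \<and> Y \<subseteq> f u"
    and k: "card {w \<in> V - {u, v}. C \<inter> f w \<noteq> {}} \<le> k"
    unfolding sees_def by blast
  have k': "card {w \<in> V - {v, u}. C \<inter> f w \<noteq> {}} \<le> k" using k by (simp add: insert_commute)
  from \<open>cone C X Y\<close> consider "plain_cone C X Y" | "bow_tie_cone C X Y" unfolding cone_def by blast
  then show ?thesis
  proof cases
    case 1
    then show ?thesis
      using sub plain_cone_necessary[OF 1 _ _ assms(2,3) k] plain_cone_necessary[OF 1 _ _ assms(3,2) k']
      by blast
  next
    case 2
    then show ?thesis
      using sub bow_tie_cone_necessary[OF 2 _ _ assms(2,3) k] bow_tie_cone_necessary[OF 2 _ _ assms(3,2) k']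
      by blast
  qed
qed

section \<open>Cones that realize visibility\<close>

text \<open>The cone ends at \<open>L\<close> and no positive endpoint has its angle in
  \<open>[a, L)\<close>, so every third arc meeting the cone is a blocker at
  \<open>L\<close>.\<close>

lemma sees_plainI:
  assumes V: "u \<in> V" "v \<in> V" and "r u < r v" "0 < L" "L \<le> l u" "L \<le> l v"
    and k: "card (plain_blockers u v L) \<le> k"
  shows "sees k V f u v"
proof -
  obtain a where a: "0 \<le> a" "a < L" and sep: "\<And>s. s \<in> l ` V \<Longrightarrow> s < L \<Longrightarrow> s < a"
    using exists_separating_below[of "l ` V" L] fin assms by blast
  have L: "L < 2 * pi" using assms l_less[of u] by simp
  define C where "C = {rcis s t | s t. r u \<le> s \<and> s \<le> r v \<and> a \<le> t \<and> t \<le> L}"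
  have "plain_cone C (circle_part (r u) a L) (circle_part (r v) a L)"
    unfolding plain_cone_def C_def using assms a L r_pos[of u]
    by (intro exI[of _ "r u"] exI[of _ "r v"] exI[of _ a] exI[of _ L]) auto
  moreover have "circle_part (r u) a L \<subseteq> f u" "circle_part (r v) a L \<subseteq> f v"
    using a assms by (auto simp: arc circle_part_def)
  moreover have "{w \<in> V - {u, v}. C \<inter> f w \<noteq> {}} \<subseteq> plain_blockers u v L"
  proof
    fix w assume "w \<in> {w \<in> V - {u, v}. C \<inter> f w \<noteq> {}}"
    then obtain s t where w: "w \<in> V" "w \<noteq> u" "w \<noteq> v" and st: "r u \<le> s" "s \<le> r v" "a \<le> t" "t \<le> L"
      and mem: "rcis s t \<in> f w" by (auto simp: C_def)
    have "s = r w \<and> t \<le> l w" using mem mem_iff[of w s t] w st a L r_pos[of u] V by auto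
    moreover have "r w \<noteq> r u" "r w \<noteq> r v" using r_eqD w V by blast+
    ultimately show "w \<in> plain_blockers u v L"
      using w st sep[of "l w"] by (force simp: plain_blockers_def)
  qed
  then have "card {w \<in> V - {u, v}. C \<inter> f w \<noteq> {}} \<le> card (plain_blockers u v L)"
    by (intro card_mono) auto
  ultimately show ?thesis using k unfolding sees_def cone_def by (meson le_trans)
qed

lemma sees_bowI:
  assumes V: "u \<in> V" "v \<in> V" and L: "0 < L" "L \<le> l u" "L + pi \<le> l v"
    and k: "card (bow_blockers u v L) \<le> k"
  shows "sees k V f u v"
proof -
  \<comment> \<open>Endpoints shifted back by \<open>pi\<close> are included so that a single
    \<open>a\<close> clears both halves of the bow-tie.\<close>
  obtain a where a: "0 \<le> a" "a < L"
    and sep: "\<And>s. s \<in> l ` V \<union> (\<lambda>w. l w - pi) ` V \<Longrightarrow> s < L \<Longrightarrow> s < a"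
    using exists_separating_below[of "l ` V \<union> (\<lambda>w. l w - pi) ` V" L] fin assms by blast
  have L2: "L + pi < 2 * pi" using assms l_less[of v] by simp
  define C where "C = {rcis s t | s t. 0 \<le> s \<and> s \<le> r u \<and> a \<le> t \<and> t \<le> L} \<union>
      {rcis s t | s t. 0 \<le> s \<and> s \<le> r v \<and> a + pi \<le> t \<and> t \<le> L + pi}"
  have "bow_tie_cone C (circle_part (r u) a L) (circle_part (r v) (a + pi) (L + pi))"
    unfolding bow_tie_cone_def C_def using assms a L2 r_pos
    by (intro exI[of _ "r u"] exI[of _ "r v"] exI[of _ a] exI[of _ L]) auto
  moreover have "circle_part (r u) a L \<subseteq> f u"
    using a assms by (auto simp: arc circle_part_def)
  moreover have "circle_part (r v) (a + pi) (L + pi) \<subseteq> f v"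
  proof -
    have "0 \<le> t \<and> t \<le> l v" if "a + pi \<le> t" "t \<le> L + pi" for t
      using that a L pi_gt_zero by linarith
    then show ?thesis by (auto simp: arc[OF V(2)] circle_part_def)
  qed
  moreover have "{w \<in> V - {u, v}. C \<inter> f w \<noteq> {}} \<subseteq> bow_blockers u v L"
  proof
    fix w assume "w \<in> {w \<in> V - {u, v}. C \<inter> f w \<noteq> {}}"
    then obtain s t where w: "w \<in> V" "w \<noteq> u" "w \<noteq> v" and s: "0 \<le> s"
      and t: "s \<le> r u \<and> a \<le> t \<and> t \<le> L \<or> s \<le> r v \<and> a + pi \<le> t \<and> t \<le> L + pi"
      and mem: "rcis s t \<in> f w" by (auto simp: C_def)
    have "0 \<le> t" "t < 2 * pi" using t a L2 pi_gt_zero by linarith+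
    then have "s = r w \<and> t \<le> l w" using mem mem_iff[of w s t] w s by auto
    moreover have "r w \<noteq> r u" "r w \<noteq> r v" using r_eqD w V by blast+
    ultimately show "w \<in> bow_blockers u v L"
      using w t sep[of "l w"] sep[of "l w - pi"] by (force simp: bow_blockers_def)
  qed
  then have "card {w \<in> V - {u, v}. C \<inter> f w \<noteq> {}} \<le> card (bow_blockers u v L)"
    by (intro card_mono) auto
  ultimately show ?thesis using k unfolding sees_def cone_def by (meson le_trans)
qed

section \<open>Charging edges to positive endpoints\<close>

text \<open>
  \<open>opp x\<close> is the angle, modulo a full turn, opposite to the positive endpoint of \<open>x\<close>. For
  \<open>l x = pi\<close> it is a full turn rather than \<open>0\<close>, because the cones approach that
  endpoint from below.
\<close>

definition opp :: "'a \<Rightarrow> real" where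
  "opp x = (if l x \<le> pi then l x + pi else l x - pi)"

definition inner :: "'a \<Rightarrow> 'a set" where
  "inner x = {w \<in> V. r w < r x \<and> l x \<le> l w}"

text \<open>These are the blockers of a bow-tie pushed up to the positive endpoint of
  \<open>x\<close>; \<open>opp\<close> treats alike the cases where \<open>x\<close> carries the
  earlier or the later end.\<close>

definition opp_blockers :: "'a \<Rightarrow> 'a \<Rightarrow> 'a set" where
  "opp_blockers x y = {w \<in> V - {x, y}. r w < r x \<and> l x \<le> l w \<or> r w < r y \<and> opp x \<le> l w}"

definition in_nbrs :: "nat \<Rightarrow> 'a \<Rightarrow> 'a set" where
  "in_nbrs k x =
     {y \<in> V - {x}. (y \<in> inner x \<and> card (plain_blockers y x (l x)) \<le> k)
        \<or> (opp x \<le> l y \<and> card (opp_blockers x y) \<le> k)}"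

definition out_nbrs :: "nat \<Rightarrow> 'a \<Rightarrow> 'a set" where
  "out_nbrs k x = {y \<in> V. r x < r y \<and> l x \<le> l y \<and> card (plain_blockers x y (l x)) \<le> k}"

text \<open>The minimum in \<open>bow_visible\<close> comes from the positive endpoint of
  \<open>u\<close> or of \<open>v\<close>; that arc is charged.\<close>

lemma bow_visible_charge:
  assumes "bow_visible k u v" "u \<in> V" "v \<in> V" "u \<noteq> v"
  shows "v \<in> in_nbrs k u \<or> u \<in> in_nbrs k v"
proof (cases "l u \<le> l v - pi")
  case True
  then have "opp u = l u + pi" "opp u \<le> l v" using assms l_less[of v] by (auto simp: opp_def)
  moreover have "opp_blockers u v = bow_blockers u v (min (l u) (l v - pi))"
    using True calculation by (auto simp: opp_blockers_def bow_blockers_def)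
  ultimately show ?thesis using assms by (auto simp: in_nbrs_def bow_visible_def)
next
  case False
  then have "opp v = l v - pi" "opp v \<le> l u" using assms by (auto simp: opp_def bow_visible_def)
  moreover have "opp_blockers v u = bow_blockers u v (min (l u) (l v - pi))"
    using False calculation by (auto simp: opp_blockers_def bow_blockers_def)
  ultimately show ?thesis using assms by (auto simp: in_nbrs_def bow_visible_def)
qed

text \<open>The shorter arc is charged: it looks outward if it is \<open>u\<close> and inward if it
  is \<open>v\<close>.\<close>

lemma plain_visible_charge:
  assumes "r u < r v" "card (plain_blockers u v (min (l u) (l v))) \<le> k" "u \<in> V" "v \<in> V"
  shows "v \<in> out_nbrs k u \<or> u \<in> in_nbrs k v"
proof (cases "l u \<le> l v")
  case True
  then have "min (l u) (l v) = l u" by simp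
  then show ?thesis using assms True by (simp add: out_nbrs_def)
next
  case False
  then have "min (l u) (l v) = l v" by simp
  moreover have "u \<noteq> v" using False by auto
  ultimately show ?thesis using assms False by (simp add: in_nbrs_def inner_def)
qed

lemma sees_charge:
  assumes "sees k V f u v" "u \<in> V" "v \<in> V" "u \<noteq> v"
  shows "v \<in> in_nbrs k u \<union> out_nbrs k u \<or> u \<in> in_nbrs k v \<union> out_nbrs k v"
  using sees_necessary[OF assms(1-3)]
proof (elim disjE conjE)
  assume "r u < r v" "card (plain_blockers u v (min (l u) (l v))) \<le> k"
  from plain_visible_charge[OF this assms(2,3)] show ?thesis by blast
next
  assume "r v < r u" "card (plain_blockers v u (min (l v) (l u))) \<le> k"
  from plain_visible_charge[OF this assms(3,2)] show ?thesis by blast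
next
  assume "bow_visible k u v"
  from bow_visible_charge[OF this assms(2-4)] show ?thesis by blast
next
  assume "bow_visible k v u"
  from bow_visible_charge[OF this assms(3,2) assms(4)[symmetric]] show ?thesis by blast
qed

text \<open>Arcs outside \<open>x\<close> that reach angle \<open>l x\<close> are met by increasing
  radius, each blocking all later ones. The second bound is what yields the saving for the outermost
  arcs.\<close>

lemma card_out_nbrs:
  assumes "x \<in> V"
  shows "card (out_nbrs k x) \<le> min (k + 1) (card {y \<in> V. r x < r y})"
proof -
  let ?P = "{w \<in> V. r x < r w \<and> l x \<le> l w}"
  have "plain_blockers x y (l x) = {w \<in> ?P. r w < r y}" for y
    by (auto simp: plain_blockers_def)
  then have "out_nbrs k x \<subseteq>
      {y \<in> ?P. card {w \<in> ?P. r w < r y} \<le> k \<and> (\<forall>w\<in>?P. r w = r y \<longrightarrow> w = y)}"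
    using r_eqD by (auto simp: out_nbrs_def)
  then have "card (out_nbrs k x) \<le>
      card {y \<in> ?P. card {w \<in> ?P. r w < r y} \<le> k \<and> (\<forall>w\<in>?P. r w = r y \<longrightarrow> w = y)}"
    using fin by (intro card_mono) auto
  also have "\<dots> \<le> k + 1" using fin by (intro card_few_predecessors_le) auto
  finally have "card (out_nbrs k x) \<le> k + 1" .
  moreover have "card (out_nbrs k x) \<le> card {y \<in> V. r x < r y}"
    using fin by (intro card_mono) (auto simp: out_nbrs_def)
  ultimately show ?thesis by simp
qed

text \<open>
  Looking inward from the positive endpoint of \<open>x\<close>, the line of sight passes first the arcs in
  \<open>inner x\<close> by decreasing radius and then, beyond the origin, the arcs reaching \<open>opp x\<close> by
  increasing radius; only the first \<open>k + 1\<close> arcs met can be seen.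
\<close>

lemma card_in_nbrs:
  assumes x: "x \<in> V"
  shows "card (in_nbrs k x) \<le> k + 1"
proof -
  let ?S = "in_nbrs k x"
  have fin_S: "finite ?S" and fin_B: "finite (opp_blockers x y)" for y
    using fin by (simp_all add: in_nbrs_def opp_blockers_def)
  have bound: "card ?S \<le> k + 1" if "card (opp_blockers x y) \<le> k" "?S \<subseteq> insert y (opp_blockers x y)" for y
  proof -
    have "card ?S \<le> card (insert y (opp_blockers x y))"
      using that fin_B by (intro card_mono) auto
    also have "\<dots> \<le> Suc (card (opp_blockers x y))" by (rule card_insert_le_m1) auto
    finally show ?thesis using that by simp
  qed
  \<comment> \<open>Neighbours outside \<open>inner x\<close> are seen only through the origin, and
    the one of largest radius has all other neighbours as blockers.\<close>
  let ?far = "?S - inner x"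
  show ?thesis
  proof (cases "?far = {}")
    case False
    then obtain y where y: "y \<in> ?far" "\<And>z. z \<in> ?far \<Longrightarrow> r z \<le> r y"
      using obtains_MAX[of ?far r] fin_S by (metis (no_types, lifting) Max_ge finite_Diff finite_imageI imageI)
    have "z \<in> insert y (opp_blockers x y)" if z: "z \<in> ?S" for z
    proof (cases "z \<in> inner x")
      case True
      then show ?thesis using z by (auto simp: in_nbrs_def opp_blockers_def inner_def)
    next
      case False
      then have "r z \<le> r y" using y z by blast
      then show ?thesis using False z y(1) r_eqD[of z y]
        by (force simp: in_nbrs_def opp_blockers_def)
    qed
    then show ?thesis using y(1) by (intro bound[of y]) (auto simp: in_nbrs_def)
  next
    case True
    show ?thesis
    \<comment> \<open>All neighbours now lie in \<open>inner x\<close>, so if one of them is seen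
      through the origin, all the others block that view.\<close>
    proof (cases "\<exists>y\<in>?S. card (opp_blockers x y) \<le> k")
      case True': True
      then obtain y where y: "y \<in> ?S" "card (opp_blockers x y) \<le> k" by blast
      have "?S \<subseteq> insert y (opp_blockers x y)"
        using True by (auto simp: in_nbrs_def opp_blockers_def inner_def)
      then show ?thesis by (intro bound[of y] y)
    next
      case False
      let ?P = "inner x"
      \<comment> \<open>Looking inward, arcs are met by decreasing radius, hence the negated
        key.\<close>
      have "plain_blockers y x (l x) = {w \<in> ?P. - r w < - r y}" for y
        by (auto simp: plain_blockers_def inner_def)
      then have "?S \<subseteq>
          {y \<in> ?P. card {w \<in> ?P. - r w < - r y} \<le> k \<and> (\<forall>w\<in>?P. - r w = - r y \<longrightarrow> w = y)}"
        using False r_eqD by (auto simp: in_nbrs_def) (auto simp: inner_def)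
      then have "card ?S \<le>
          card {y \<in> ?P. card {w \<in> ?P. - r w < - r y} \<le> k \<and> (\<forall>w\<in>?P. - r w = - r y \<longrightarrow> w = y)}"
        using fin by (intro card_mono) (auto simp: inner_def)
      also have "\<dots> \<le> k + 1" using fin by (intro card_few_predecessors_le) (auto simp: inner_def)
      finally show ?thesis .
    qed
  qed
qed

text \<open>Each edge is charged to an end, so summing the inward and outward bounds over
  \<open>V\<close> bounds \<open>card E\<close>; the result is doubled to stay in the
  naturals.\<close>

lemma card_edges:
  assumes E: "\<And>e. e \<in> E \<Longrightarrow> \<exists>u v. e = {u, v} \<and> u \<in> V \<and> v \<in> V \<and> u \<noteq> v \<and> sees k V f u v"
    and n: "k + 1 \<le> card V"
  shows "2 * card E + (k + 1) * (k + 2) \<le> 4 * (k + 1) * card V"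
proof -
  have fin_N: "finite (in_nbrs k x \<union> out_nbrs k x)" for x
    using fin by (simp add: in_nbrs_def out_nbrs_def)
  have "E \<subseteq> (\<Union>x\<in>V. (\<lambda>y. {x, y}) ` (in_nbrs k x \<union> out_nbrs k x))"
  proof
    fix e assume "e \<in> E"
    then obtain u v where e: "e = {u, v}" "u \<in> V" "v \<in> V" "u \<noteq> v" "sees k V f u v" using E by blast
    from sees_charge[OF e(5,2,3,4)] show "e \<in> (\<Union>x\<in>V. (\<lambda>y. {x, y}) ` (in_nbrs k x \<union> out_nbrs k x))"
    proof
      assume "v \<in> in_nbrs k u \<union> out_nbrs k u"
      then show ?thesis using e by blast
    next
      assume "u \<in> in_nbrs k v \<union> out_nbrs k v"
      moreover have "e = {v, u}" using e by auto
      ultimately show ?thesis using e by blast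
    qed
  qed
  then have "card E \<le> card (\<Union>x\<in>V. (\<lambda>y. {x, y}) ` (in_nbrs k x \<union> out_nbrs k x))"
    using fin fin_N by (intro card_mono) auto
  also have "\<dots> \<le> (\<Sum>x\<in>V. card ((\<lambda>y. {x, y}) ` (in_nbrs k x \<union> out_nbrs k x)))"
    by (rule card_UN_le[OF fin])
  also have "\<dots> \<le> (\<Sum>x\<in>V. (k + 1) + min (k + 1) (card {y \<in> V. r x < r y}))"
  proof (rule sum_mono)
    fix x assume x: "x \<in> V"
    have "card ((\<lambda>y. {x, y}) ` (in_nbrs k x \<union> out_nbrs k x)) \<le> card (in_nbrs k x \<union> out_nbrs k x)"
      by (rule card_image_le[OF fin_N])
    also have "\<dots> \<le> card (in_nbrs k x) + card (out_nbrs k x)" by (rule card_Un_le)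
    also have "\<dots> \<le> (k + 1) + min (k + 1) (card {y \<in> V. r x < r y})"
      by (intro add_mono card_in_nbrs card_out_nbrs x)
    finally show "card ((\<lambda>y. {x, y}) ` (in_nbrs k x \<union> out_nbrs k x))
      \<le> (k + 1) + min (k + 1) (card {y \<in> V. r x < r y})" .
  qed
  also have "\<dots> = (k + 1) * card V + (\<Sum>i<card V. min (k + 1) i)"
    by (simp only: sum.distrib sum_min_card_greater[OF fin r_inj] sum_constant) simp
  finally have "2 * card E \<le> 2 * (k + 1) * card V + 2 * (\<Sum>i<card V. min (k + 1) i)" by simp
  then show ?thesis using sum_min_lessThan[OF n] by (simp add: algebra_simps)
qed

end

section \<open>From representations to edge bounds\<close>

text \<open>Every arc contains its point at angle 0, so disjointness rules out equal radii.\<close>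

lemma semi_arcs_of_representation:
  assumes "finite V" "arc_visibility_rep k V E f" "\<forall>v\<in>V. arc_from 0 (f v)"
  obtains r l where "semi_arcs V f r l"
proof -
  from assms(3) have "\<forall>v\<in>V. \<exists>r b. r > 0 \<and> 0 \<le> b \<and> b < 2 * pi \<and> f v = circle_part r 0 b"
    unfolding arc_from_def by simp
  then obtain r l where rl: "\<And>v. v \<in> V \<Longrightarrow> r v > 0 \<and> 0 \<le> l v \<and> l v < 2 * pi \<and> f v = circle_part (r v) 0 (l v)"
    by metis
  have "inj_on r V"
  proof (rule inj_onI, rule ccontr)
    fix u v assume uv: "u \<in> V" "v \<in> V" "r u = r v" "u \<noteq> v"
    have "rcis (r u) 0 \<in> f u \<inter> f v" using rl[of u] rl[of v] uv by (auto simp: circle_part_def)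
    moreover have "f u \<inter> f v = {}"
      using assms(2) uv by (auto simp: arc_visibility_rep_def disjoint_family_on_def)
    ultimately show False by blast
  qed
  with rl assms(1) have "semi_arcs V f r l" by unfold_locales auto
  then show thesis by (rule that)
qed

lemma semi_arc_edge_counts_le:
  assumes "m \<in> semi_arc_edge_counts k n" "k + 1 \<le> n"
  shows "2 * m + (k + 1) * (k + 2) \<le> 4 * (k + 1) * n"
proof -
  from assms(1) obtain V :: "nat set" and E f where m: "m = card E" "card V = n"
    and g: "simple_graph V E" and rep: "arc_visibility_rep k V E f" "\<forall>v\<in>V. arc_from 0 (f v)"
    unfolding semi_arc_edge_counts_def semi_arc_visibility_graph_def by blast
  have "finite V" using g by (simp add: simple_graph_def)
  then obtain r l where "semi_arcs V f r l" using semi_arcs_of_representation rep by blast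
  then interpret semi_arcs V f r l .
  have "\<exists>u v. e = {u, v} \<and> u \<in> V \<and> v \<in> V \<and> u \<noteq> v \<and> sees k V f u v" if e: "e \<in> E" for e
  proof -
    have "e \<subseteq> V" "card e = 2" using g e by (auto simp: simple_graph_def)
    then obtain u v where "e = {u, v}" "u \<noteq> v" "u \<in> V" "v \<in> V" by (auto simp: card_2_iff)
    then show ?thesis using rep(1) e unfolding arc_visibility_rep_def by blast
  qed
  from card_edges[OF this] show ?thesis using assms m by simp
qed

lemma semi_arc_edge_counts_le_choose:
  assumes "m \<in> semi_arc_edge_counts k n"
  shows "m \<le> n choose 2"
proof -
  from assms obtain V :: "nat set" and E where m: "m = card E" "card V = n"
    and g: "simple_graph V E"
    unfolding semi_arc_edge_counts_def semi_arc_visibility_graph_def by blast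
  have "finite V" "E \<subseteq> {e. e \<subseteq> V \<and> card e = 2}" using g by (auto simp: simple_graph_def)
  then have "card E \<le> card {e. e \<subseteq> V \<and> card e = 2}" by (intro card_mono) auto
  also have "\<dots> = n choose 2" using n_subsets[OF \<open>finite V\<close>] m by simp
  finally show ?thesis using m by simp
qed

section \<open>Complete graphs\<close>

text \<open>
  Three groups of at most \<open>k + 1\<close> arcs by increasing radius. The groups have lengths in
  \<open>(1, 3 / 2]\<close>, \<open>(3 / 2, 2)\<close> and \<open>(pi, pi + 1)\<close>, which decrease with the radius in
  the first two and increase in the third. Hence between different groups a plain cone, or a
  bow-tie from the first to the third, meets at most the other arcs of a single group.
\<close>

definition clique_length :: "nat \<Rightarrow> nat \<Rightarrow> real" where
  "clique_length k v =
     (if v \<le> k then 1 + 1 / (real v + 2)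
      else if v \<le> 2 * k + 1 then 3 / 2 + 1 / (real v + 2)
      else pi + 1 - 1 / (real v + 2))"

lemma clique_visible:
  fixes k n :: nat
  assumes n: "n \<le> 3 * k + 3" and "semi_arcs {..<n} f (\<lambda>v. real v + 1) (clique_length k)"
    and uv: "u < v" "v < n"
  shows "sees k {..<n} f u v"
proof -
  interpret semi_arcs "{..<n}" f "\<lambda>v. real v + 1" "clique_length k" by fact
  let ?l = "clique_length k"
  \<comment> \<open>The offset 2 keeps \<open>h\<close> in \<open>(0, 1 / 2]\<close>, with
    \<open>1 / 2\<close> only at 0, so the length ranges of the groups stay apart.\<close>
  define h where "h w = 1 / (real w + 2)" for w :: nat
  have len: "?l w = (if w \<le> k then 1 + h w else if w \<le> 2 * k + 1 then 3 / 2 + h w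
      else pi + 1 - h w)" for w
    by (simp add: clique_length_def h_def)
  have h: "0 < h w" "h w \<le> 1 / 2" "0 < w \<Longrightarrow> h w < 1 / 2" for w
    by (simp_all add: h_def field_simps)
  have mono: "h w < h v" if "v < w" for v w
    using that by (simp add: h_def frac_less2)
  have A: "1 < ?l w \<and> ?l w \<le> 3 / 2" if "w \<le> k" for w
    using that h(1,2)[of w] by (simp add: len)
  have B: "3 / 2 < ?l w \<and> ?l w < 2" if "k < w" "w \<le> 2 * k + 1" for w
    using that h(1)[of w] h(3)[of w] by (simp add: len)
  have C: "pi < ?l w \<and> ?l w < pi + 1" if "2 * k + 1 < w" for w
    using that h(1,2)[of w] by (simp add: len)
  have pos: "0 < ?l w" for w using A[of w] B[of w] C[of w] pi_ge_two by linarith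
  have card_le: "card S \<le> k" if "S \<subseteq> {a..<b}" "b \<le> a + k" for S :: "nat set" and a b
    using card_mono[OF _ that(1)] that(2) by simp
  have plain: "sees k {..<n} f u v"
    if "plain_blockers u v (min (?l u) (?l v)) \<subseteq> {a..<b}" "b \<le> a + k" for a b
    using uv pos card_le[OF that] by (intro sees_plainI[where L = "min (?l u) (?l v)"]) auto
  \<comment> \<open>At most \<open>k\<close> radii lie strictly between those of \<open>u\<close>
    and \<open>v\<close>, whatever the lengths.\<close>
  have near: "sees k {..<n} f u v" if "v \<le> u + k + 1"
    using that by (intro plain[of "Suc u" v]) (auto simp: plain_blockers_def)
  \<comment> \<open>Two arcs of one group always fall under the first case, as a group has at most
    \<open>k + 1\<close> arcs.\<close>
  consider "v \<le> u + k + 1" | "u \<le> k" "k < v" "v \<le> 2 * k + 1"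
    | "k < u" "u \<le> 2 * k + 1" "2 * k + 1 < v" | "u \<le> k" "2 * k + 1 < v"
    using uv n by linarith
  then show ?thesis
  proof cases
    case 1
    then show ?thesis by (rule near)
  next
    case 2
    \<comment> \<open>The view is at the positive endpoint of \<open>u\<close>. Later arcs of its
      group are too short to reach it, so only arcs of the group of \<open>v\<close> block.\<close>
    have "?l u < ?l v" using A B 2 by fastforce
    moreover have "?l w < ?l u" if "u < w" "w \<le> k" for w
      using that mono[of u w] by (simp add: len)
    ultimately show ?thesis using 2
      by (intro plain[of "Suc k" v]) (force simp: plain_blockers_def not_le[symmetric])+
  next
    case 3
    have "?l u < ?l v" using B[of u] C[of v] 3 pi_ge_two by simp
    moreover have "?l w < ?l u" if "u < w" "w \<le> 2 * k + 1" for w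
      using that 3 mono[of u w] by (simp add: len)
    ultimately show ?thesis using 3 uv n
      by (intro plain[of "2 * k + 2" v]) (force simp: plain_blockers_def not_le[symmetric])+
  next
    case 4
    \<comment> \<open>On the side of \<open>u\<close> only the \<open>u \<le> k\<close> arcs inside
      it can block; on the side of \<open>v\<close> no arc inside it is as long as
      \<open>v\<close>.\<close>
    have "bow_blockers u v (?l v - pi) \<subseteq> {0..<u}"
    proof
      fix w assume "w \<in> bow_blockers u v (?l v - pi)"
      then have w: "w < u \<or> w < v \<and> ?l v \<le> ?l w" by (auto simp: bow_blockers_def)
      have "?l w < ?l v" if "w < v"
      proof (cases "2 * k + 1 < w")
        case True
        then show ?thesis using that mono[of w v] by (simp add: len)
      next
        case False
        then show ?thesis using A[of w] B[of w] C[of v] 4 pi_ge_two by linarith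
      qed
      with w show "w \<in> {0..<u}" by force
    qed
    moreover have "?l v - pi \<le> ?l u" "0 < ?l v - pi" using A[of u] C[of v] 4 by auto
    ultimately show ?thesis using uv 4
      by (intro sees_bowI[where L = "?l v - pi"] card_le[of _ 0 u]) auto
  qed
qed

lemma choose_in_semi_arc_edge_counts:
  assumes n: "n \<le> 3 * k + 3"
  shows "n choose 2 \<in> semi_arc_edge_counts k n"
proof -
  let ?V = "{..<n}"
  define f where "f v = circle_part (real v + 1) 0 (clique_length k v)" for v
  define E where "E = {e. e \<subseteq> ?V \<and> card e = 2}"
  have len: "0 \<le> clique_length k v \<and> clique_length k v < 2 * pi" for v
  proof -
    define h where "h = 1 / (real v + 2)"
    have "0 < h" "h < 1" by (simp_all add: h_def field_simps)
    then show ?thesis using pi_ge_two unfolding clique_length_def h_def[symmetric] by auto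
  qed
  interpret semi_arcs ?V f "\<lambda>v. real v + 1" "clique_length k"
    using len by unfold_locales (auto simp: f_def inj_on_def)
  have arcs: "arc_from 0 (f v)" for v
    unfolding arc_from_def f_def using len[of v]
    by (intro exI[of _ "real v + 1"] exI[of _ "clique_length k v"]) auto
  have "disjoint_family_on f ?V"
  proof -
    have "cmod z = real v + 1" if "z \<in> f v" for z v
      using that by (auto simp: f_def circle_part_def)
    then have "real u + 1 = real v + 1" if "z \<in> f u" "z \<in> f v" for z u v
      using that by metis
    then have "f u \<inter> f v = {}" if "u \<noteq> v" for u v using that by auto
    then show ?thesis by (simp add: disjoint_family_on_def)
  qed
  moreover have "sees k ?V f u v" if "u \<in> ?V" "v \<in> ?V" "u \<noteq> v" for u v
    using clique_visible[OF n semi_arcs_axioms, of u v] clique_visible[OF n semi_arcs_axioms, of v u]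
      sees_commute[of k ?V f u v] that by (cases "u < v") auto
  ultimately have "arc_visibility_rep k ?V E f"
    using arcs by (auto simp: arc_visibility_rep_def is_arc_def E_def)
  moreover have "simple_graph ?V E" by (auto simp: simple_graph_def E_def)
  ultimately have "semi_arc_visibility_graph k ?V E"
    using arcs by (auto simp: semi_arc_visibility_graph_def)
  moreover have "card E = n choose 2" using n_subsets[of ?V 2] by (simp add: E_def)
  ultimately show ?thesis
    unfolding semi_arc_edge_counts_def by (intro CollectI exI[of _ E] exI[of _ ?V]) simp
qed

theorem theorem13:
  fixes k n :: nat
  assumes "n \<ge> 1"
  shows "(n \<le> 3 * k + 3 \<longrightarrow> Max (semi_arc_edge_counts k n) = n choose 2) \<and>
         (n > 3 * k + 3 \<longrightarrow>
            real (Max (semi_arc_edge_counts k n)) \<le>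
              (real k + 1) * (2 * real n - (real k + 2) / 2))"
proof (intro conjI impI)
  assume "n \<le> 3 * k + 3"
  then show "Max (semi_arc_edge_counts k n) = n choose 2"
    by (intro Max_eqI finite_semi_arc_edge_counts semi_arc_edge_counts_le_choose
        choose_in_semi_arc_edge_counts)
next
  assume "n > 3 * k + 3"
  let ?m = "Max (semi_arc_edge_counts k n)"
  have "?m \<in> semi_arc_edge_counts k n"
    by (rule Max_in[OF finite_semi_arc_edge_counts semi_arc_edge_counts_nonempty])
  then have "2 * ?m + (k + 1) * (k + 2) \<le> 4 * (k + 1) * n"
    using \<open>n > 3 * k + 3\<close> by (intro semi_arc_edge_counts_le) auto
  then have "real (2 * ?m + (k + 1) * (k + 2)) \<le> real (4 * (k + 1) * n)"
    by (simp only: of_nat_le_iff)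
  then show "real ?m \<le> (real k + 1) * (2 * real n - (real k + 2) / 2)"
    by (simp add: field_simps)
qed

end
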